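(* Let $Q$ be an involutory quandle. The following conditions on $Q$ are equivalent. (i) There do not exist a trajectory $(x_i)_{i\in\mathbb{Z}}$ in $Q$ and a positive integer $n$ divisible by $4$ such that for all $i,j\in\mathbb{Z}$ one has $x_i=x_j$ if and only if either $i$ and $j$ are both odd and $i\equiv j \pmod{n/2}$, or $i$ and $j$ are both even and $i\equiv j\pmod n$. (ii) If $(x_i)_{i\in\mathbb{Z}}$ is a trajectory in $Q$ and $i,j,m$ are integers, then $x_i=x_{i+m}\iff x_j=x_{j+m}$. (i$'$) There do not exist a trajectory $(x_i)_{i\in\mathbb{Z}}$ in $Q$ and a positive integer $n$ divisible by $4$ which is a power of $2$, such that for all $i,j\in\mathbb{Z}$ one has $x_i=x_j$ if and only if either $i$ and $j$ are both odd and $i\equiv j \pmod{n/2}$, or $i$ and $j$ are both even and $i\equiv j\pmod n$. (ii$'$) If $(x_i)_{i\in\mathbb{Z}}$ is a trajectory in $Q$ and $m\geq 2$ is a power of $2$, then $x_0=x_m\implies x_1=x_{m+1}$. Moreover, every involutory quandle $Q$ that is embeddable in $\mathrm{Core}(G)$ for some group $G$ satisfies these equivalent conditions.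
   Context: An involutory quandle is a set $Q$ with a binary operation $\lhd$ such that for all $x,y,z\in Q$: $x\lhd x=x$; $x\lhd(x\lhd y)=y$; and $x\lhd(y\lhd z)=(x\lhd y)\lhd(x\lhd z)$ (given the second law, the last is equivalent to $(x\lhd y)\lhd z=x\lhd(y\lhd(x\lhd z))$). For a group $G$, $\mathrm{Core}(G)$ is the involutory quandle with the same underlying set as $G$ and operation $x\lhd y=xy^{-1}x$. "Embeddable" means that there is an injective $\lhd$-homomorphism. A trajectory in an involutory quandle $Q$ is a sequence $(x_i)_{i\in\mathbb{Z}}$ of elements of $Q$ such that $x_{i+1}=x_i\lhd x_{i-1}$ for all $i\in\mathbb{Z}$ (equivalently, $x_{i-1}=x_i\lhd x_{i+1}$ for all $i$). *)

theory Defs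
  imports "HOL-Algebra.Group" "HOL-Number_Theory.Cong"
begin

record 'a quandle = "'a partial_object" +
  qop :: "'a \<Rightarrow> 'a \<Rightarrow> 'a" (infixl "\<lhd>\<index>" 70)

locale involutory_quandle =
  fixes Q :: "('a, 'b) quandle_scheme" (structure)
  assumes qop_closed: "\<lbrakk>x \<in> carrier Q; y \<in> carrier Q\<rbrakk> \<Longrightarrow> x \<lhd> y \<in> carrier Q"
    and qop_idem: "x \<in> carrier Q \<Longrightarrow> x \<lhd> x = x"
    and qop_invol: "\<lbrakk>x \<in> carrier Q; y \<in> carrier Q\<rbrakk> \<Longrightarrow> x \<lhd> (x \<lhd> y) = y"
    and qop_distrib: "\<lbrakk>x \<in> carrier Q; y \<in> carrier Q; z \<in> carrier Q\<rbrakk>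
      \<Longrightarrow> x \<lhd> (y \<lhd> z) = (x \<lhd> y) \<lhd> (x \<lhd> z)"

definition quandle_hom ::
  "('a, 'b) quandle_scheme \<Rightarrow> ('c, 'd) quandle_scheme \<Rightarrow> ('a \<Rightarrow> 'c) set" where
  "quandle_hom Q R = {f \<in> carrier Q \<rightarrow> carrier R.
     \<forall>x\<in>carrier Q. \<forall>y\<in>carrier Q. f (x \<lhd>\<^bsub>Q\<^esub> y) = f x \<lhd>\<^bsub>R\<^esub> f y}"

definition embeddable ::
  "('a, 'b) quandle_scheme \<Rightarrow> ('c, 'd) quandle_scheme \<Rightarrow> bool" where
  "embeddable Q R \<longleftrightarrow> (\<exists>f \<in> quandle_hom Q R. inj_on f (carrier Q))"

definition Core :: "('a, 'b) monoid_scheme \<Rightarrow> 'a quandle" where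
  "Core G = \<lparr>carrier = carrier G, qop = (\<lambda>x y. x \<otimes>\<^bsub>G\<^esub> inv\<^bsub>G\<^esub> y \<otimes>\<^bsub>G\<^esub> x)\<rparr>"

lemma involutory_quandle_Core:
  assumes "group G"
  shows "involutory_quandle (Core G)"
proof -
  interpret group G by fact
  have cancel: "x \<otimes>\<^bsub>G\<^esub> (inv\<^bsub>G\<^esub> x \<otimes>\<^bsub>G\<^esub> y) = y" "inv\<^bsub>G\<^esub> x \<otimes>\<^bsub>G\<^esub> (x \<otimes>\<^bsub>G\<^esub> y) = y"
    if "x \<in> carrier G" "y \<in> carrier G" for x y
    using that by (simp_all flip: m_assoc)
  show ?thesis
    by unfold_locales (simp_all add: Core_def m_assoc inv_mult_group cancel)
qed

definition trajectory :: "('a, 'b) quandle_scheme \<Rightarrow> (int \<Rightarrow> 'a) \<Rightarrow> bool" where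
  "trajectory Q x \<longleftrightarrow>
     range x \<subseteq> carrier Q \<and> (\<forall>i. x (i + 1) = x i \<lhd>\<^bsub>Q\<^esub> x (i - 1))"

definition parity_periodic :: "(int \<Rightarrow> 'a) \<Rightarrow> int \<Rightarrow> bool" where
  "parity_periodic x n \<longleftrightarrow>
     (\<forall>i j. x i = x j \<longleftrightarrow>
        (odd i \<and> odd j \<and> [i = j] (mod n div 2)) \<or>
        (even i \<and> even j \<and> [i = j] (mod n)))"

definition no_parity_periodic_trajectory :: "('a, 'b) quandle_scheme \<Rightarrow> bool" where
  "no_parity_periodic_trajectory Q \<longleftrightarrow>
     \<not> (\<exists>x n. trajectory Q x \<and> 0 < n \<and> 4 dvd n \<and> parity_periodic x n)"

definition translation_invariant_coincidences :: "('a, 'b) quandle_scheme \<Rightarrow> bool" where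
  "translation_invariant_coincidences Q \<longleftrightarrow>
     (\<forall>x i j m. trajectory Q x \<longrightarrow> (x i = x (i + m) \<longleftrightarrow> x j = x (j + m)))"

definition no_two_power_parity_periodic_trajectory :: "('a, 'b) quandle_scheme \<Rightarrow> bool" where
  "no_two_power_parity_periodic_trajectory Q \<longleftrightarrow>
     \<not> (\<exists>x n. trajectory Q x \<and> 0 < n \<and> 4 dvd n \<and> (\<exists>k::nat. n = 2 ^ k) \<and>
          parity_periodic x n)"

definition two_power_coincidences_shift :: "('a, 'b) quandle_scheme \<Rightarrow> bool" where
  "two_power_coincidences_shift Q \<longleftrightarrow>
     (\<forall>x m. trajectory Q x \<and> 2 \<le> m \<and> (\<exists>k::nat. m = 2 ^ k) \<longrightarrow>
        x 0 = x m \<longrightarrow> x 1 = x (m + 1))"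

end

theory Submission
  imports Defs
begin

text \<open>
  In a trajectory, $x_i \lhd x_j = x_{2i-j}$. Hence a coincidence $x_i = x_j$ is preserved by even
  shifts, and it makes $2(j-i)$ a period of the whole trajectory. The sets $E$ and $O$ of those $m$
  with $x_0 = x_m$, respectively $x_1 = x_{1+m}$, agree as soon as one of them has an odd element.
  If they differ, they are therefore subgroups $e\mathbb{Z}$, $o\mathbb{Z}$ of $2\mathbb{Z}$ with
  $o \mid 2e$ and $e \mid 2o$, so that $e = 2o$ after a shift of the trajectory; this is the
  excluded pattern with $n = e$. Passing to $x_{qi}$, with $q$ the odd part of $n$, reduces to
  powers of $2$. In $\mathrm{Core}(G)$ a trajectory satisfies $x_{i+1} = g x_i$ for a fixed $g$.
\<close>

section \<open>Subgroups of the integers and divisibility\<close>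

lemma int_subgroup_eq_multiples:
  fixes H :: "int set"
  assumes "0 \<in> H" and diff: "\<And>a b. a \<in> H \<Longrightarrow> b \<in> H \<Longrightarrow> a - b \<in> H"
  obtains d where "d \<ge> 0" "H = {m. d dvd m}"
proof (cases "H = {0}")
  case True
  then show ?thesis by (intro that[of 0]) auto
next
  case False
  have neg: "- a \<in> H" if "a \<in> H" for a
    using diff[OF \<open>0 \<in> H\<close> that] by simp
  have add: "a + b \<in> H" if "a \<in> H" "b \<in> H" for a b
    using diff[OF that(1) neg[OF that(2)]] by simp
  from False \<open>0 \<in> H\<close> obtain a where "a \<in> H" "a \<noteq> 0" by blast
  then have "int (nat \<bar>a\<bar>) \<in> H \<and> nat \<bar>a\<bar> > 0"
    using neg by (auto simp: abs_if)
  then have ex: "\<exists>n. int n \<in> H \<and> n > 0" by blast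
  define n where "n = (LEAST n. int n \<in> H \<and> n > 0)"
  have n: "int n \<in> H" "n > 0"
    using LeastI_ex[OF ex] by (auto simp: n_def)
  have least: "n \<le> k" if "int k \<in> H" "k > 0" for k
    unfolding n_def using that by (intro Least_le) simp
  have nat_mult: "int k * int n \<in> H" for k
    by (induction k) (auto simp: \<open>0 \<in> H\<close> distrib_right intro: add n)
  have mult: "k * int n \<in> H" for k
    using nat_mult[of "nat k"] neg[OF nat_mult[of "nat (- k)"]] by (cases "k \<ge> 0") auto
  have "int n dvd m" if "m \<in> H" for m
  proof -
    have "m mod int n \<in> H"
      using diff[OF that mult[of "m div int n"]] by (simp add: minus_div_mult_eq_mod)
    moreover have "0 \<le> m mod int n" "m mod int n < int n"
      using n(2) by auto
    ultimately have "m mod int n = 0"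
      using least[of "nat (m mod int n)"] by (cases "m mod int n = 0") auto
    then show ?thesis by auto
  qed
  moreover have "m \<in> H" if "int n dvd m" for m
    using that mult by (auto simp: dvd_def mult.commute)
  ultimately show ?thesis
    by (intro that[of "int n"]) auto
qed

text \<open>Writing \<open>2 * e = d * k\<close> and \<open>2 * d = e * l\<close> gives
  \<open>k * l = 4\<close>; an even \<open>l\<close> would make \<open>e\<close> divide
  \<open>d\<close>, so \<open>l = 1\<close>.\<close>

lemma eq_double_if_dvd_doubles:
  fixes d e :: int
  assumes "d \<ge> 0" "e \<ge> 0" "d dvd 2 * e" "e dvd 2 * d" "\<not> e dvd d"
  shows "e = 2 * d"
proof -
  from assms obtain k l where k: "2 * e = d * k" and l: "2 * d = e * l"
    by (auto simp: dvd_def)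
  have "d > 0" using assms by (cases "d = 0") auto
  have "e > 0" using l \<open>d > 0\<close> assms(2) by (cases "e = 0") auto
  have "odd l"
  proof
    assume "even l"
    then obtain l' where "l = 2 * l'" ..
    with l have "d = e * l'" by simp
    with assms(5) show False by simp
  qed
  have "d * (k * l) = d * 4"
    using k l by (metis mult.assoc mult.commute mult_2 numeral_Bit0)
  then have "k * l = 4" using \<open>d > 0\<close> by simp
  then have "l dvd 4" by (metis dvd_triv_right)
  moreover have "l > 0"
    using l \<open>d > 0\<close> \<open>e > 0\<close> by (metis zero_less_mult_pos zero_less_mult_iff zero_less_numeral)
  ultimately have "l \<le> 4" by (auto dest: zdvd_imp_le)
  with \<open>l > 0\<close> have "l = 1 \<or> l = 2 \<or> l = 3 \<or> l = 4" by auto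
  with \<open>odd l\<close> \<open>l dvd 4\<close> have "l = 1" by auto
  with l show ?thesis by simp
qed

section \<open>The excluded pattern in terms of shifts\<close>

text \<open>Because 4 divides \<open>n\<close>, both \<open>n\<close> and \<open>n div 2\<close> are
  even, so divisibility of \<open>j - i\<close> by either already forces \<open>i\<close> and
  \<open>j\<close> to have the same parity.\<close>

lemma parity_periodicI:
  assumes even: "\<And>i m. even i \<Longrightarrow> x i = x (i + m) \<longleftrightarrow> n dvd m"
    and odd: "\<And>i m. odd i \<Longrightarrow> x i = x (i + m) \<longleftrightarrow> n div 2 dvd m"
    and n: "4 dvd n"
  shows "parity_periodic x n"
  unfolding parity_periodic_def
proof (intro allI)
  fix i j :: int
  from n have "even n" "even (n div 2)" by (auto elim!: dvdE)
  have "even i = even j" if "even k" "k dvd j - i" for k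
    using dvd_trans[OF that] by simp
  note parity = this[OF \<open>even n\<close>] this[OF \<open>even (n div 2)\<close>]
  have cong: "[i = j] (mod k) \<longleftrightarrow> k dvd j - i" for k
    by (simp add: cong_iff_dvd_diff dvd_diff_commute)
  show "x i = x j \<longleftrightarrow> odd i \<and> odd j \<and> [i = j] (mod n div 2) \<or> even i \<and> even j \<and> [i = j] (mod n)"
    using even[of i "j - i"] odd[of i "j - i"] parity unfolding cong by auto
qed

lemma parity_periodic_even:
  assumes "parity_periodic x n" "even n" "even i"
  shows "x i = x (i + m) \<longleftrightarrow> n dvd m"
proof -
  have "x i = x (i + m) \<longleftrightarrow> even (i + m) \<and> [i = i + m] (mod n)"
    using assms unfolding parity_periodic_def by simp
  also have "[i = i + m] (mod n) \<longleftrightarrow> n dvd m"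
    by (simp add: cong_iff_dvd_diff)
  finally show ?thesis using assms by (auto dest: dvd_trans)
qed

lemma parity_periodic_odd:
  assumes "parity_periodic x n" "4 dvd n" "odd i"
  shows "x i = x (i + m) \<longleftrightarrow> n div 2 dvd m"
proof -
  have "x i = x (i + m) \<longleftrightarrow> odd (i + m) \<and> [i = i + m] (mod n div 2)"
    using assms unfolding parity_periodic_def by simp
  also have "[i = i + m] (mod n div 2) \<longleftrightarrow> n div 2 dvd m"
    by (simp add: cong_iff_dvd_diff)
  finally have "x i = x (i + m) \<longleftrightarrow> odd (i + m) \<and> n div 2 dvd m" .
  moreover have "even (n div 2)" using assms(2) by (auto elim!: dvdE)
  then have "even m" if "n div 2 dvd m" using that by (rule dvd_trans)
  ultimately show ?thesis using assms(3) by auto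
qed

section \<open>Reflections and coincidences in trajectories\<close>

context involutory_quandle
begin

lemma trajectory_closed: "trajectory Q x \<Longrightarrow> x i \<in> carrier Q"
  by (auto simp: trajectory_def)

lemma trajectory_step: "trajectory Q x \<Longrightarrow> x i \<lhd> x (i - 1) = x (i + 1)"
  by (auto simp: trajectory_def)

text \<open>Strong induction on the distance. For \<open>k = l + 2\<close>, the point
  \<open>x (i + k)\<close> is the reflection of \<open>x (i - l)\<close> in
  \<open>x (i + 1)\<close>; reflecting this relation in \<open>x i\<close> by distributivity leaves
  a reflection in \<open>x (i - 1)\<close> over the shorter distance \<open>l + 1\<close>.\<close>

lemma trajectory_reflect_nat:
  assumes "trajectory Q x"
  shows "x i \<lhd> x (i + int k) = x (i - int k)"
proof (induction k arbitrary: i rule: less_induct)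
  case (less k)
  note closed = trajectory_closed[OF assms]
  consider "k = 0" | "k = 1" | l where "k = l + 2"
    by (metis One_nat_def add_2_eq_Suc' not0_implies_Suc)
  then show ?case
  proof cases
    case 1
    then show ?thesis by (simp add: qop_idem closed)
  next
    case 2
    then show ?thesis
      using qop_invol[OF closed closed, of i "i - 1"] by (simp add: trajectory_step[OF assms])
  next
    case (3 l)
    have "x (i + int k) = x (i + 1) \<lhd> x (i - int l)"
      using less.IH[of "l + 1" "i + 1"] qop_invol[OF closed closed, of "i + 1" "i + int k"] 3
      by (simp add: algebra_simps)
    then have "x i \<lhd> x (i + int k) = (x i \<lhd> x (i + 1)) \<lhd> (x i \<lhd> x (i - int l))"
      by (simp add: qop_distrib closed)
    also have "x i \<lhd> x (i + 1) = x (i - 1)"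
      using less.IH[of 1 i] 3 by simp
    also have "x i \<lhd> x (i - int l) = x (i + int l)"
      using less.IH[of l i] qop_invol[OF closed closed, of i "i + int l"] 3 by simp
    also have "x (i - 1) \<lhd> x (i + int l) = x (i - int k)"
      using less.IH[of "l + 1" "i - 1"] 3 by (simp add: algebra_simps)
    finally show ?thesis .
  qed
qed

lemma trajectory_reflect:
  assumes "trajectory Q x"
  shows "x i \<lhd> x j = x (2 * i - j)"
proof (cases "i \<le> j")
  case True
  then show ?thesis
    using trajectory_reflect_nat[OF assms, of i "nat (j - i)"] by (simp add: algebra_simps)
next
  case False
  then have "x i \<lhd> x (2 * i - j) = x j"
    using trajectory_reflect_nat[OF assms, of i "nat (i - j)"] by (simp add: algebra_simps)
  then show ?thesis
    using qop_invol[OF trajectory_closed trajectory_closed, OF assms assms] by metis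
qed

lemma trajectory_affine:
  assumes "trajectory Q x"
  shows "trajectory Q (\<lambda>i. x (a * i + b))"
  using assms trajectory_reflect[OF assms]
  by (auto simp: trajectory_def algebra_simps)

text \<open>An even shift is a composite of two reflections: \<open>x 0\<close> sends index
  \<open>i\<close> to \<open>- i\<close>, and \<open>x l\<close> sends \<open>- i\<close> to
  \<open>i + 2 * l\<close>.\<close>

lemma trajectory_coincidence_shift:
  assumes "trajectory Q x" "x i = x j" "even k"
  shows "x (i + k) = x (j + k)"
proof -
  from \<open>even k\<close> obtain l where "k = 2 * l" ..
  have "x (- i) = x (- j)"
    using trajectory_reflect[OF assms(1), of 0] assms(2) by (metis mult_zero_right diff_0)
  then have "x l \<lhd> x (- i) = x l \<lhd> x (- j)" by simp
  then show ?thesis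
    by (simp add: trajectory_reflect[OF assms(1)] \<open>k = 2 * l\<close> add.commute)
qed

lemma trajectory_coincidence_shift_iff:
  assumes "trajectory Q x" "even (i - j)"
  shows "x i = x (i + m) \<longleftrightarrow> x j = x (j + m)"
  using trajectory_coincidence_shift[OF assms(1), of i "i + m" "j - i"]
    trajectory_coincidence_shift[OF assms(1), of j "j + m" "i - j"] assms(2)
  by (auto simp: algebra_simps)

text \<open>Equal elements act as the same reflection; on \<open>x (2 * i - k)\<close> the two sides
  give \<open>x k\<close> and \<open>x (k + 2 * m)\<close>.\<close>

lemma trajectory_coincidence_period:
  assumes "trajectory Q x" "x i = x (i + m)"
  shows "x k = x (k + 2 * m)"
proof -
  have "x i \<lhd> x (2 * i - k) = x (i + m) \<lhd> x (2 * i - k)"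
    using assms(2) by simp
  then show ?thesis
    by (simp add: trajectory_reflect[OF assms(1)] algebra_simps)
qed

text \<open>If \<open>k\<close> and \<open>i\<close> differ in parity, then \<open>k + m\<close> has
  the parity of \<open>i\<close>, so \<open>x (k + m) = x (k + 2 * m)\<close>, which is
  \<open>x k\<close> by the period \<open>2 * m\<close>.\<close>

lemma trajectory_odd_coincidence_period:
  assumes "trajectory Q x" "x i = x (i + m)" "odd m"
  shows "x k = x (k + m)"
proof (cases "even (k - i)")
  case True
  then show ?thesis
    using trajectory_coincidence_shift_iff[OF assms(1)] assms(2) by blast
next
  case False
  then have "x (k + m) = x (k + m + m)"
    using trajectory_coincidence_shift_iff[OF assms(1), of "k + m" i m] assms(2,3) by simp
  then show ?thesis
    using trajectory_coincidence_period[OF assms(1,2), of k] by (simp add: algebra_simps)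
qed

lemma trajectory_coincidences_eq_multiples:
  assumes "trajectory Q x" and even: "\<forall>m. x i = x (i + m) \<longrightarrow> even m"
  obtains d where "d \<ge> 0" "\<And>m. x i = x (i + m) \<longleftrightarrow> d dvd m"
proof -
  \<comment> \<open>Evenness of \<open>b\<close> is what permits shifting
    \<open>x (i + b) = x (i + a)\<close> back by \<open>b\<close>.\<close>
  have "a - b \<in> {m. x i = x (i + m)}"
    if "a \<in> {m. x i = x (i + m)}" "b \<in> {m. x i = x (i + m)}" for a b
    using trajectory_coincidence_shift[OF assms(1), of "i + b" "i + a" "- b"] that even
    by (simp add: algebra_simps)
  then obtain d where "d \<ge> 0" "{m. x i = x (i + m)} = {m. d dvd m}"
    by (rule int_subgroup_eq_multiples[rotated]) auto
  then show ?thesis by (intro that) auto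
qed

lemma parity_periodic_shift_of_coincidence:
  assumes "trajectory Q x" "x 1 = x (1 + m)" "x 0 \<noteq> x m"
  obtains n where "0 < n" "4 dvd n" "parity_periodic x n"
proof -
  note period = trajectory_coincidence_period[OF assms(1)]
  \<comment> \<open>An odd \<open>p\<close> would be a period of the whole trajectory. It would
    carry the coincidence at 1 to the even index \<open>1 + p\<close>, and an even shift would bring
    it to 0.\<close>
  have even: "even p" if "x i = x (i + p)" for i p
  proof (rule ccontr)
    assume "odd p"
    then have p: "x k = x (k + p)" for k
      using trajectory_odd_coincidence_period[OF assms(1) that] by blast
    have "x (1 + p) = x (1 + p + m)"
      using p[of 1] p[of "1 + m"] assms(2) by (simp add: algebra_simps)
    then have "x 0 = x (0 + m)"
      using trajectory_coincidence_shift_iff[OF assms(1), of "1 + p" 0 m] \<open>odd p\<close> by simp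
    with assms(3) show False by simp
  qed
  then have even': "\<forall>p. x i = x (i + p) \<longrightarrow> even p" for i by blast
  obtain e where e: "e \<ge> 0" "\<And>k. x 0 = x (0 + k) \<longleftrightarrow> e dvd k"
    using trajectory_coincidences_eq_multiples[OF assms(1) even'] by blast
  obtain d where d: "d \<ge> 0" "\<And>k. x 1 = x (1 + k) \<longleftrightarrow> d dvd k"
    using trajectory_coincidences_eq_multiples[OF assms(1) even'] by blast
  have "e dvd 2 * d" using e(2)[of "2 * d"] d(2)[of d] period[of 1 d 0] by simp
  moreover have "d dvd 2 * e" using d(2)[of "2 * e"] e(2)[of e] period[of 0 e 1] by simp
  \<comment> \<open>The shift \<open>m\<close> is a multiple of \<open>d\<close> but not of
    \<open>e\<close>; this breaks the symmetry and selects \<open>e = 2 * d\<close> over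
    \<open>d = 2 * e\<close>.\<close>
  moreover have "\<not> e dvd d"
    using d(2)[of m] e(2)[of m] assms(2,3) by (auto dest: dvd_trans)
  ultimately have "e = 2 * d"
    using eq_double_if_dvd_doubles d(1) e(1) by blast
  moreover have "even d" using even[of 1 d] d(2)[of d] by simp
  moreover have "d \<noteq> 0" using \<open>\<not> e dvd d\<close> by auto
  ultimately have "0 < e" "4 dvd e" "e div 2 = d" using d(1) by auto
  moreover have "parity_periodic x e"
  proof (rule parity_periodicI)
    show "x i = x (i + k) \<longleftrightarrow> e dvd k" if "even i" for i k
      using trajectory_coincidence_shift_iff[OF assms(1), of i 0 k] e(2)[of k] that by simp
    show "x i = x (i + k) \<longleftrightarrow> e div 2 dvd k" if "odd i" for i k
      using trajectory_coincidence_shift_iff[OF assms(1), of i 1 k] d(2)[of k] that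
      by (simp add: \<open>e div 2 = d\<close>)
  qed fact
  ultimately show ?thesis using that by blast
qed

section \<open>Implications between the conditions\<close>

lemma translation_invariant_if_no_parity_periodic:
  assumes "no_parity_periodic_trajectory Q"
  shows "translation_invariant_coincidences Q"
proof -
  have "x j = x (j + m)" if x: "trajectory Q x" and i: "x i = x (i + m)" for x i j m
  proof (rule ccontr)
    assume j: "x j \<noteq> x (j + m)"
    \<comment> \<open>The shift moves the coincidence at \<open>i\<close> to index 1; the factor 1
      matches the form of \<open>trajectory_affine\<close>.\<close>
    define y where "y k = x (1 * k + (i - 1))" for k
    have y: "trajectory Q y"
      unfolding y_def by (rule trajectory_affine[OF x])
    \<comment> \<open>Since \<open>i\<close> and \<open>j\<close> have opposite parity,
      \<open>i - 1\<close> has the parity of \<open>j\<close> and inherits the failure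
      there.\<close>
    have "odd (j - i)"
      using trajectory_coincidence_shift_iff[OF x, of j i m] i j by auto
    then have "x (i - 1) \<noteq> x (i - 1 + m)"
      using trajectory_coincidence_shift_iff[OF x, of j "i - 1" m] j by simp
    then have "y 0 \<noteq> y m" by (simp add: y_def algebra_simps)
    moreover have "y 1 = y (1 + m)" using i by (simp add: y_def algebra_simps)
    ultimately obtain n where "0 < n" "4 dvd n" "parity_periodic y n"
      using parity_periodic_shift_of_coincidence[OF y] by blast
    with y assms show False
      unfolding no_parity_periodic_trajectory_def by blast
  qed
  then show ?thesis
    unfolding translation_invariant_coincidences_def by blast
qed

lemma no_parity_periodic_if_no_two_power:
  assumes "no_two_power_parity_periodic_trajectory Q"
  shows "no_parity_periodic_trajectory Q"
  unfolding no_parity_periodic_trajectory_def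
proof (safe)
  fix x and n :: int
  assume x: "trajectory Q x" and n: "0 < n" "4 dvd n" and per: "parity_periodic x n"
  from n(2) have "even n" by (auto elim!: dvdE)
  from n(1) obtain q where q: "n = 2 ^ multiplicity 2 n * q" "odd q"
    using multiplicity_decompose'[of n 2] by auto
  define k where "k = multiplicity 2 n"
  \<comment> \<open>This keeps 4 a divisor of the 2-part \<open>N\<close> and makes
    \<open>n div 2 = q * (N div 2)\<close> exact.\<close>
  have "multiplicity 2 n \<ge> 2"
    using n by (intro multiplicity_geI) auto
  then obtain l where l: "k = l + 2"
    by (metis k_def le_add_diff_inverse2)
  define N :: int where "N = 2 ^ k"
  have N: "0 < N" "4 dvd N" by (simp_all add: N_def l)
  have nN: "n = q * N" unfolding N_def k_def by (subst mult.commute) (rule q(1))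
  have half: "n div 2 = q * (N div 2)"
    using nN by (simp add: N_def l)
  have "q \<noteq> 0" using q(2) by auto
  \<comment> \<open>Multiplication by the odd \<open>q\<close> preserves the parity of indices, and
    \<open>q\<close> cancels from both divisibility conditions.\<close>
  define y where "y i = x (q * i + 0)" for i
  have y: "trajectory Q y"
    unfolding y_def by (rule trajectory_affine[OF x])
  have "parity_periodic y N"
  proof (rule parity_periodicI)
    show "y i = y (i + m) \<longleftrightarrow> N dvd m" if "even i" for i m
      using parity_periodic_even[OF per \<open>even n\<close>, of "q * i" "q * m"] that \<open>q \<noteq> 0\<close>
      by (simp add: y_def nN algebra_simps)
    show "y i = y (i + m) \<longleftrightarrow> N div 2 dvd m" if "odd i" for i m
      using parity_periodic_odd[OF per n(2), of "q * i" "q * m"] that q(2) \<open>q \<noteq> 0\<close>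
      unfolding half by (simp add: y_def distrib_left)
  qed fact
  with y N assms show False
    unfolding no_two_power_parity_periodic_trajectory_def N_def by blast
qed

lemma no_two_power_if_coincidences_shift:
  assumes "two_power_coincidences_shift Q"
  shows "no_two_power_parity_periodic_trajectory Q"
  unfolding no_two_power_parity_periodic_trajectory_def
proof (safe)
  fix x and k :: nat
  assume x: "trajectory Q x" and n: "4 dvd (2 :: int) ^ k"
    and per: "parity_periodic x (2 ^ k)"
  have "k \<noteq> 0" using n by (intro notI) simp
  then obtain l where l: "k = Suc l" using not0_implies_Suc by blast
  \<comment> \<open>The shift used below is \<open>2 ^ l\<close>, half of the period
    \<open>2 ^ k\<close>; it has to be at least 2.\<close>
  have "l \<noteq> 0" using n by (intro notI) (simp add: l)
  then have "(2 :: int) ^ 1 \<le> 2 ^ l" by (intro power_increasing) auto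
  \<comment> \<open>The odd index 1 moves to 0, where \<open>2 ^ l\<close> is a coincidence, and the
    even index 2 moves to 1, where it is not.\<close>
  moreover define y where "y i = x (1 * i + 1)" for i
  have "trajectory Q y"
    unfolding y_def by (rule trajectory_affine[OF x])
  moreover have "y 0 = y (2 ^ l)"
    using parity_periodic_odd[OF per n, of 1 "2 ^ l"] by (simp add: y_def l add.commute)
  ultimately have "y 1 = y (2 ^ l + 1)"
    using assms unfolding two_power_coincidences_shift_def by auto
  then have "(2 :: int) ^ k dvd 2 ^ l"
    using parity_periodic_even[OF per, of 2 "2 ^ l"] \<open>k \<noteq> 0\<close> by (simp add: y_def add.commute)
  then show False by (auto simp: l dest: zdvd_imp_le)
qed

end

lemma coincidences_shift_if_translation_invariant:
  assumes "translation_invariant_coincidences Q"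
  shows "two_power_coincidences_shift Q"
  unfolding two_power_coincidences_shift_def
proof (intro allI impI)
  fix x and m :: int
  assume "trajectory Q x \<and> 2 \<le> m \<and> (\<exists>k::nat. m = 2 ^ k)" "x 0 = x m"
  then have "x 1 = x (1 + m)"
    using assms unfolding translation_invariant_coincidences_def by (metis add_0)
  then show "x 1 = x (m + 1)" by (simp add: add.commute)
qed

lemma no_two_power_if_no_parity_periodic:
  "no_parity_periodic_trajectory Q \<Longrightarrow> no_two_power_parity_periodic_trajectory Q"
  unfolding no_parity_periodic_trajectory_def no_two_power_parity_periodic_trajectory_def by blast

section \<open>Cores of groups and embedded quandles\<close>

lemma translation_invariant_Core:
  assumes "group G"
  shows "translation_invariant_coincidences (Core G)"
proof -
  interpret group G by fact
  have "x i = x (i + m) \<longleftrightarrow> x j = x (j + m)" if "trajectory (Core G) x" for x i j m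
  proof -
    have [simp]: "x i \<in> carrier G" for i
      using that by (auto simp: trajectory_def Core_def)
    have step: "x (i + 1) = x i \<otimes>\<^bsub>G\<^esub> inv\<^bsub>G\<^esub> x (i - 1) \<otimes>\<^bsub>G\<^esub> x i" for i
      using that by (simp add: trajectory_def Core_def)
    define g where "g i = x (i + 1) \<otimes>\<^bsub>G\<^esub> inv\<^bsub>G\<^esub> x i" for i
    have g_closed [simp]: "g i \<in> carrier G" for i by (simp add: g_def)
    \<comment> \<open>The last factor \<open>x i\<close> of the step formula cancels against
      \<open>inv x i\<close>, leaving the quotient one index earlier.\<close>
    have "g (i - 1) = g i" for i
      by (simp add: g_def step[of i] m_assoc)
    then have "g (i + 1) = g i" for i
      by (metis add_diff_cancel_right')
    then have g: "g i = g 0" for i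
      using \<open>\<And>i. g (i - 1) = g i\<close> by (induction i rule: int_induct[where k = 0]) auto
    have "x (i + 1) = g i \<otimes>\<^bsub>G\<^esub> x i" for i
      by (simp add: g_def m_assoc)
    then have mult: "x (i + 1) = g 0 \<otimes>\<^bsub>G\<^esub> x i" for i
      using g[of i] by metis
    \<comment> \<open>Left multiplication by the constant \<open>g 0\<close> is injective, so
      coincidences pass between neighbouring indices in both directions.\<close>
    have shift: "x (i + 1) = x (i + 1 + m) \<longleftrightarrow> x i = x (i + m)" for i
      using mult[of i] mult[of "i + m"] by (simp add: algebra_simps)
    have "x i = x (i + m) \<longleftrightarrow> x 0 = x (0 + m)" for i
    proof (induction i rule: int_induct[where k = 0])
      case (step2 i)
      then show ?case using shift[of "i - 1"] by simp
    qed (simp_all add: shift)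
    then show ?thesis by blast
  qed
  then show ?thesis
    unfolding translation_invariant_coincidences_def by blast
qed

text \<open>A homomorphism maps trajectories to trajectories, and injectivity pulls coincidences of
  the image back to \<open>Q\<close>.\<close>

lemma translation_invariant_if_embeddable:
  assumes "embeddable Q R" "translation_invariant_coincidences R"
  shows "translation_invariant_coincidences Q"
proof -
  from assms(1) obtain f where f: "f \<in> quandle_hom Q R" "inj_on f (carrier Q)"
    by (auto simp: embeddable_def)
  have "x i = x (i + m) \<longleftrightarrow> x j = x (j + m)" if x: "trajectory Q x" for x i j m
  proof -
    have closed: "x i \<in> carrier Q" for i using x by (auto simp: trajectory_def)
    have step: "x (i + 1) = x i \<lhd>\<^bsub>Q\<^esub> x (i - 1)" for i using x by (simp add: trajectory_def)
    have "trajectory R (f \<circ> x)"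
      using f(1) closed step by (auto simp: trajectory_def quandle_hom_def)
    then have "f (x i) = f (x (i + m)) \<longleftrightarrow> f (x j) = f (x (j + m))"
      using assms(2) unfolding translation_invariant_coincidences_def comp_def by blast
    then show ?thesis using inj_on_eq_iff[OF f(2) closed closed] by simp
  qed
  then show ?thesis
    unfolding translation_invariant_coincidences_def by blast
qed

theorem proposition5p2:
  fixes Q :: "('a, 'b) quandle_scheme"
  assumes "involutory_quandle Q"
  shows "(no_parity_periodic_trajectory Q \<longleftrightarrow> translation_invariant_coincidences Q)
    \<and> (translation_invariant_coincidences Q \<longleftrightarrow> no_two_power_parity_periodic_trajectory Q)
    \<and> (no_two_power_parity_periodic_trajectory Q \<longleftrightarrow> two_power_coincidences_shift Q)
    \<and> (\<forall>G :: ('g, 'm) monoid_scheme. group G \<and> embeddable Q (Core G) \<longrightarrow>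
         no_parity_periodic_trajectory Q \<and> translation_invariant_coincidences Q
         \<and> no_two_power_parity_periodic_trajectory Q \<and> two_power_coincidences_shift Q)"
proof -
  interpret involutory_quandle Q by fact
  have "translation_invariant_coincidences Q"
    if "group G" "embeddable Q (Core G)" for G :: "('g, 'm) monoid_scheme"
    using that translation_invariant_if_embeddable translation_invariant_Core by blast
  \<comment> \<open>The implications close a cycle: \<open>no_parity_periodic_trajectory\<close>,
    \<open>translation_invariant_coincidences\<close>, \<open>two_power_coincidences_shift\<close>,
    \<open>no_two_power_parity_periodic_trajectory\<close>, and back to the first.\<close>
  then show ?thesis
    using translation_invariant_if_no_parity_periodic no_parity_periodic_if_no_two_power
      no_two_power_if_coincidences_shift coincidences_shift_if_translation_invariant[of Q]
      no_two_power_if_no_parity_periodic[of Q]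
    by blast
qed

end
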